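(* Let $\mathcal{S}_1$ and $\mathcal{S}_2$ be non-empty separated convex sets. If both $\mathcal{S}_1$ and $\mathcal{S}_2$ are finite-dimensional, then the topology on $\mathcal{A}^c(\widetilde{\mathcal{S}}_1,\widetilde{\mathcal{S}}_2)$ (the subspace topology of the modified compact-open topology on $C(\widetilde{\mathcal{S}}_1,\widetilde{\mathcal{S}}_2)$ generated by the sets $O_{K,U}$ with $K$ essential closed and $U$ essential open) coincides with the topology determined by the metric $d_{\infty}$ (or equivalently, the compact-open topology), and $\mathcal{A}^c(\widetilde{\mathcal{S}}_1,\widetilde{\mathcal{S}}_2)$ is compact.
   Context: All vector spaces are real; convex sets are non-empty convex subsets of vector spaces. A convex set $\mathcal{S}$ is separated if for any distinct $s_1,s_2\in\mathcal{S}$ there is an affine functional $f:\mathcal{S}\to\mathbb{R}$ with bounded image and $f(s_1)\ne f(s_2)$; for a convex subset of a finite-dimensional Euclidean space this is equivalent to boundedness. For a finite-dimensional separated convex set $\mathcal{S}$ with $\dim(\mathcal{S})=n$, $\mathcal{S}$ is regarded as a (bounded) convex subset of the Euclidean space $V(\mathcal{S})=\mathbb{R}^n$ whose affine hull is $V(\mathcal{S})$; $\widetilde{\mathcal{S}}$ is the closure of $\mathcal{S}$ in $V(\mathcal{S})$, which is convex and compact; $d_{\mathcal{S}}$ denotes the Euclidean metric on $V(\mathcal{S})$. An open subset $O$ of $\widetilde{\mathcal{S}}$ is essential if $\mathrm{int}_{\widetilde{\mathcal{S}}}(O\cup(\widetilde{\mathcal{S}}\setminus\mathcal{S}))=O$;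 a closed subset $C$ of $\widetilde{\mathcal{S}}$ is essential if $\mathrm{cl}_{\widetilde{\mathcal{S}}}(C\cap\mathcal{S})=C$ (interior and closure relative to $\widetilde{\mathcal{S}}$). $C(\widetilde{\mathcal{S}}_1,\widetilde{\mathcal{S}}_2)$ is the set of continuous maps $\widetilde{\mathcal{S}}_1\to\widetilde{\mathcal{S}}_2$, with the topology having as subbase all sets $O_{K,U}=\{f\in C(\widetilde{\mathcal{S}}_1,\widetilde{\mathcal{S}}_2)\mid f(K)\subset U\}$ with $K$ an essential closed subset of $\widetilde{\mathcal{S}}_1$ and $U$ an essential open subset of $\widetilde{\mathcal{S}}_2$. $\mathcal{A}^c(\widetilde{\mathcal{S}}_1,\widetilde{\mathcal{S}}_2)\subset C(\widetilde{\mathcal{S}}_1,\widetilde{\mathcal{S}}_2)$ is the subset of continuous affine maps, with the subspace topology. The metric $d_\infty$ on $C(\widetilde{\mathcal{S}}_1,\widetilde{\mathcal{S}}_2)$ is $d_{\infty}(f,g)=\sup_{s\in\widetilde{\mathcal{S}}_1}d_{\mathcal{S}_2}(f(s),g(s))$. *)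

theory Defs
  imports "HOL-Analysis.Analysis"
begin

definition affine_on :: "'a::real_vector set \<Rightarrow> ('a \<Rightarrow> 'b::real_vector) \<Rightarrow> bool" where
  "affine_on S f \<longleftrightarrow>
     (\<forall>x\<in>S. \<forall>y\<in>S. \<forall>t\<in>{0..1::real}.
        f ((1 - t) *\<^sub>R x + t *\<^sub>R y) = (1 - t) *\<^sub>R f x + t *\<^sub>R f y)"

definition separated_convex :: "'a::real_vector set \<Rightarrow> bool" where
  "separated_convex S \<longleftrightarrow> S \<noteq> {} \<and> convex S \<and>
     (\<forall>s1\<in>S. \<forall>s2\<in>S. s1 \<noteq> s2 \<longrightarrow>
        (\<exists>f :: 'a \<Rightarrow> real. affine_on S f \<and> bounded (f ` S) \<and> f s1 \<noteq> f s2))"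

definition finite_dimensional :: "'a::real_vector set \<Rightarrow> bool" where
  "finite_dimensional S \<longleftrightarrow> (\<exists>B. finite B \<and> S \<subseteq> affine hull B)"

text \<open>A realization of an abstract convex set \<open>S\<close> as a convex subset \<open>e ` S\<close> of a Euclidean
  space. The space \<open>V(S)\<close> is \<open>affine hull (e ` S)\<close> with the metric of the ambient type, a copy of
  \<open>\<real>\<^sup>n\<close> for \<open>n = dim S\<close>. Asking instead that the affine hull be the whole type would exclude
  \<open>n = 0\<close>, since every type of class \<open>euclidean_space\<close> has positive dimension.\<close>

definition euclidean_realization :: "'a::real_vector set \<Rightarrow> ('a \<Rightarrow> 'v::euclidean_space) \<Rightarrow> bool" where
  "euclidean_realization S e \<longleftrightarrow> affine_on S e \<and> inj_on e S"

text \<open>From here on \<open>S\<close> denotes a set in a Euclidean space and \<open>closure S\<close> is its completion: affine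
  hulls are closed, so this is also the closure of \<open>S\<close> within \<open>affine hull S\<close>.\<close>

definition essential_open :: "'v::euclidean_space set \<Rightarrow> 'v set \<Rightarrow> bool" where
  "essential_open S U \<longleftrightarrow> openin (top_of_set (closure S)) U \<and>
     (top_of_set (closure S)) interior_of (U \<union> (closure S - S)) = U"

definition essential_closed :: "'v::euclidean_space set \<Rightarrow> 'v set \<Rightarrow> bool" where
  "essential_closed S C \<longleftrightarrow> closedin (top_of_set (closure S)) C \<and>
     (top_of_set (closure S)) closure_of (C \<inter> S) = C"

text \<open>Maps between the closures are represented by functions that are \<open>undefined\<close> outside
  the domain, so that equality of functions is equality of maps.\<close>

definition cmaps :: "'v::euclidean_space set \<Rightarrow> 'w::euclidean_space set \<Rightarrow> ('v \<Rightarrow> 'w) set" where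
  "cmaps S1 S2 = {f \<in> closure S1 \<rightarrow>\<^sub>E closure S2. continuous_on (closure S1) f}"

definition affine_cmaps :: "'v::euclidean_space set \<Rightarrow> 'w::euclidean_space set \<Rightarrow> ('v \<Rightarrow> 'w) set" where
  "affine_cmaps S1 S2 = {f \<in> cmaps S1 S2. affine_on (closure S1) f}"

text \<open>Taking \<open>K = {}\<close> shows that each of the two subbases below covers \<open>cmaps S1 S2\<close>, which is
  therefore the carrier of both topologies.\<close>

definition essential_compact_open_topology ::
    "'v::euclidean_space set \<Rightarrow> 'w::euclidean_space set \<Rightarrow> ('v \<Rightarrow> 'w) topology" where
  "essential_compact_open_topology S1 S2 = topology_generated_by
     {{f \<in> cmaps S1 S2. f ` K \<subseteq> U} | K U. essential_closed S1 K \<and> essential_open S2 U}"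

definition compact_open_topology ::
    "'v::euclidean_space set \<Rightarrow> 'w::euclidean_space set \<Rightarrow> ('v \<Rightarrow> 'w) topology" where
  "compact_open_topology S1 S2 = topology_generated_by
     {{f \<in> cmaps S1 S2. f ` K \<subseteq> U} | K U.
        compactin (top_of_set (closure S1)) K \<and> openin (top_of_set (closure S2)) U}"

text \<open>The value \<open>0\<close> off \<open>cmaps S1 S2\<close> is there because the locale \<open>Metric_space\<close> asks for
  nonnegativity and symmetry on the whole type.\<close>

definition d_infty ::
    "'v::euclidean_space set \<Rightarrow> 'w::euclidean_space set \<Rightarrow> ('v \<Rightarrow> 'w) \<Rightarrow> ('v \<Rightarrow> 'w) \<Rightarrow> real" where
  "d_infty S1 S2 f g =
     (if f \<in> cmaps S1 S2 \<and> g \<in> cmaps S1 S2 then (SUP s\<in>closure S1. dist (f s) (g s)) else 0)"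

lemma Metric_space_d_infty:
  assumes "S1 \<noteq> {}" and "bounded S2"
  shows "Metric_space (cmaps S1 S2) (d_infty S1 S2)"
proof -
  have ne: "closure S1 \<noteq> {}"
    using assms(1) by simp
  have bd: "bdd_above ((\<lambda>s. dist (f s) (g s)) ` closure S1)"
    if "f \<in> cmaps S1 S2" "g \<in> cmaps S1 S2" for f g
  proof -
    have "dist (f s) (g s) \<le> diameter (closure S2)" if "s \<in> closure S1" for s
      using that \<open>f \<in> _\<close> \<open>g \<in> _\<close> assms(2)
      by (intro diameter_bounded_bound) (auto simp: cmaps_def PiE_def Pi_def)
    then show ?thesis
      by (auto simp: bdd_above_def)
  qed
  have up: "dist (f s) (g s) \<le> d_infty S1 S2 f g"
    if "f \<in> cmaps S1 S2" "g \<in> cmaps S1 S2" "s \<in> closure S1" for f g s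
    using that bd[OF that(1,2)] by (auto simp: d_infty_def intro: cSUP_upper)
  have nonneg: "0 \<le> d_infty S1 S2 f g" for f g
  proof (cases "f \<in> cmaps S1 S2 \<and> g \<in> cmaps S1 S2")
    case True
    then show ?thesis
      using up[of f g] ne by (meson zero_le_dist order_trans all_not_in_conv)
  qed (auto simp: d_infty_def)
  show ?thesis
  proof
    show "0 \<le> d_infty S1 S2 f g" for f g
      by (rule nonneg)
    show "d_infty S1 S2 f g = d_infty S1 S2 g f" for f g
      by (simp add: d_infty_def dist_commute)
    show "d_infty S1 S2 f g = 0 \<longleftrightarrow> f = g"
      if fg: "f \<in> cmaps S1 S2" "g \<in> cmaps S1 S2" for f g
    proof
      assume 0: "d_infty S1 S2 f g = 0"
      have "f s = g s" if "s \<in> closure S1" for s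
        using up[OF fg that] 0 by simp
      then show "f = g"
        using fg by (auto simp: cmaps_def intro: PiE_ext)
    qed (use ne fg in \<open>simp add: d_infty_def\<close>)
    show "d_infty S1 S2 f h \<le> d_infty S1 S2 f g + d_infty S1 S2 g h"
      if fgh: "f \<in> cmaps S1 S2" "g \<in> cmaps S1 S2" "h \<in> cmaps S1 S2" for f g h
    proof -
      have "dist (f s) (h s) \<le> d_infty S1 S2 f g + d_infty S1 S2 g h" if "s \<in> closure S1" for s
        using up[OF fgh(1,2) that] up[OF fgh(2,3) that] dist_triangle[of "f s" "h s" "g s"]
        by linarith
      then have "(SUP s\<in>closure S1. dist (f s) (h s)) \<le> d_infty S1 S2 f g + d_infty S1 S2 g h"
        using ne by (intro cSUP_least)
      then show ?thesis
        using fgh by (simp add: d_infty_def)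
    qed
  qed
qed

end

theory Submission
  imports Defs "HOL-Complex_Analysis.Great_Picard"
begin

text \<open>On \<open>affine_cmaps S1 S2\<close> the essential compact-open topology is coarser than the compact-open
  topology, which is coarser than the metric one. The metric topology is compact: around a relative
  interior point \<open>S1\<close> contains a relative ball, so affine maps into the bounded set \<open>closure S2\<close> are
  uniformly Lipschitz and the theorem of Arzela and Ascoli applies. The coarsest of the three is
  already Hausdorff, because two maps differ at a point of \<open>S1\<close>, and disjoint open sets become
  essential without meeting when points outside of \<open>S2\<close> are added. A continuous bijection from a
  compact onto a Hausdorff space is a homeomorphism, so all three topologies agree.\<close>

section \<open>Separated convex sets in Euclidean space are bounded\<close>

lemma affine_onD:
  assumes "affine_on S f" "x \<in> S" "y \<in> S" "0 \<le> t" "t \<le> 1"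
  shows "f ((1 - t) *\<^sub>R x + t *\<^sub>R y) = (1 - t) *\<^sub>R f x + t *\<^sub>R f y"
  using assms by (auto simp: affine_on_def)

lemma convex_affine_image:
  assumes "convex S" "affine_on S e"
  shows "convex (e ` S)"
  unfolding convex_alt
proof (intro ballI allI impI)
  fix p q :: 'b and u :: real
  assume "p \<in> e ` S" "q \<in> e ` S" and u: "0 \<le> u \<and> u \<le> 1"
  then obtain x y where xy: "x \<in> S" "y \<in> S" "p = e x" "q = e y"
    by auto
  have "(1 - u) *\<^sub>R x + u *\<^sub>R y \<in> S"
    using assms(1) xy u by (auto simp: convex_alt)
  moreover have "e ((1 - u) *\<^sub>R x + u *\<^sub>R y) = (1 - u) *\<^sub>R p + u *\<^sub>R q"
    using assms(2) xy u by (auto intro: affine_onD)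
  ultimately show "(1 - u) *\<^sub>R p + u *\<^sub>R q \<in> e ` S"
    by (metis imageI)
qed

text \<open>A separating functional composed with the inverse of \<open>e\<close> is affine on the
  image and takes the same values. Separation thus passes from the abstract set to its Euclidean
  copy.\<close>

lemma separated_convex_affine_image:
  assumes S: "separated_convex S" and e: "affine_on S e" "inj_on e S"
  shows "separated_convex (e ` S)"
  unfolding separated_convex_def
proof (intro conjI ballI impI)
  have cS: "convex S"
    using S by (simp add: separated_convex_def)
  show "e ` S \<noteq> {}"
    using S by (simp add: separated_convex_def)
  show "convex (e ` S)"
    using cS e(1) by (rule convex_affine_image)
  fix p q
  assume pq: "p \<in> e ` S" "q \<in> e ` S" "p \<noteq> q"
  then obtain x y where xy: "x \<in> S" "y \<in> S" "p = e x" "q = e y"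
    by auto
  then obtain f :: "'a \<Rightarrow> real" where f: "affine_on S f" "bounded (f ` S)" "f x \<noteq> f y"
    using S pq(3) unfolding separated_convex_def by metis
  define g where "g = f \<circ> the_inv_into S e"
  have ge: "g (e z) = f z" if "z \<in> S" for z
    using the_inv_into_f_f[OF e(2) that] by (simp add: g_def)
  have "affine_on (e ` S) g"
    unfolding affine_on_def
  proof (intro ballI)
    fix p q t
    assume "p \<in> e ` S" "q \<in> e ` S" and t: "t \<in> {0..1::real}"
    then obtain x y where xy: "x \<in> S" "y \<in> S" "p = e x" "q = e y"
      by auto
    have "(1 - t) *\<^sub>R x + t *\<^sub>R y \<in> S"
      using cS xy t by (auto simp: convex_alt)
    then show "g ((1 - t) *\<^sub>R p + t *\<^sub>R q) = (1 - t) *\<^sub>R g p + t *\<^sub>R g q"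
      using ge xy t affine_onD[OF e(1) xy(1,2)] affine_onD[OF f(1) xy(1,2)]
      by (metis atLeastAtMost_iff)
  qed
  moreover have "g ` e ` S = f ` S"
    using ge by (auto simp: image_iff)
  ultimately show "\<exists>g :: 'b \<Rightarrow> real. affine_on (e ` S) g \<and> bounded (g ` e ` S) \<and> g p \<noteq> g q"
    using f xy ge by metis
qed

text \<open>The unit directions from \<open>x\<close> to ever more distant points of
  \<open>C\<close> accumulate at some \<open>v\<close>. Segments from \<open>x\<close> to those
  points put the ray along \<open>v\<close> into \<open>closure C\<close>, and since
  \<open>x\<close> is a relative interior point the ray lies in \<open>C\<close> itself.\<close>

lemma unbounded_convex_contains_ray:
  fixes C :: "'v::euclidean_space set"
  assumes C: "convex C" "\<not> bounded C" and x: "x \<in> rel_interior C"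
  obtains v where "v \<noteq> 0" "\<And>t. 0 \<le> t \<Longrightarrow> x + t *\<^sub>R v \<in> C"
proof -
  have xC: "x \<in> C"
    using x rel_interior_subset by blast
  have "\<exists>y\<in>C. real n < norm (y - x)" for n
  proof (rule ccontr)
    assume "\<not> (\<exists>y\<in>C. real n < norm (y - x))"
    then have "C \<subseteq> cball x (real n)"
      by (auto simp: dist_norm norm_minus_commute)
    then show False
      using C(2) bounded_cball bounded_subset by blast
  qed
  then obtain y where y: "\<And>n. y n \<in> C" "\<And>n. real n < norm (y n - x)"
    by metis
  define u where "u n = (y n - x) /\<^sub>R norm (y n - x)" for n
  have pos: "0 < norm (y n - x)" for n
    using y(2)[of n] of_nat_0_le_iff[of n, where 'a = real] by linarith
  have "\<forall>n. u n \<in> sphere 0 1"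
    using pos by (auto simp: u_def)
  then obtain v r where v: "v \<in> sphere 0 1" "strict_mono r" "(u \<circ> r) \<longlonglongrightarrow> v"
    using compact_sphere[of "0::'v" 1] unfolding compact_def by metis
  have cl: "x + t *\<^sub>R v \<in> closure C" if "0 \<le> t" for t
  proof (rule Lim_in_closed_set)
    show "(\<lambda>n. x + t *\<^sub>R (u \<circ> r) n) \<longlonglongrightarrow> x + t *\<^sub>R v"
      using v(3) by (intro tendsto_intros)
    \<comment> \<open>From this index on the point lies on the segment from \<open>x\<close> to
      \<open>y (r n)\<close>, because
      \<open>t \<le> n \<le> r n < norm (y (r n) - x)\<close>.\<close>
    have "x + t *\<^sub>R (u \<circ> r) n \<in> C" if n: "n \<ge> nat \<lceil>t\<rceil>" for n
    proof -
      let ?N = "norm (y (r n) - x)"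
      have "t \<le> real n"
        using n by linarith
      also have "\<dots> \<le> real (r n)"
        using v(2) by (simp add: seq_suble)
      finally have "t \<le> ?N"
        using y(2)[of "r n"] by linarith
      then have "(1 - t / ?N) *\<^sub>R x + (t / ?N) *\<^sub>R y (r n) \<in> C"
        using C(1) xC y(1) pos[of "r n"] \<open>0 \<le> t\<close> by (auto simp: convex_alt)
      also have "(1 - t / ?N) *\<^sub>R x + (t / ?N) *\<^sub>R y (r n) = x + t *\<^sub>R (u \<circ> r) n"
        by (simp add: u_def algebra_simps divide_inverse)
      finally show ?thesis .
    qed
    then show "eventually (\<lambda>n. x + t *\<^sub>R (u \<circ> r) n \<in> closure C) sequentially"
      using closure_subset by (blast intro: eventually_sequentiallyI)
  qed auto
  show ?thesis
  proof
    show "v \<noteq> 0"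
      using v(1) by auto
    fix t :: real
    assume t: "0 \<le> t"
    show "x + t *\<^sub>R v \<in> C"
    proof (cases "t = 0")
      case False
      \<comment> \<open>The point is the midpoint of \<open>x\<close> and the point of parameter
        \<open>2 * t\<close>. The latter is only known to be in the closure, but the open segment
        leading to it from a relative interior point stays in \<open>C\<close>.\<close>
      have "x + t *\<^sub>R v \<in> open_segment x (x + (2 * t) *\<^sub>R v)"
        using False \<open>v \<noteq> 0\<close> unfolding in_segment
        by (auto intro!: exI[of _ "1/2"] simp: algebra_simps simp flip: scaleR_add_left)
      then show ?thesis
        using rel_interior_closure_convex_segment[OF C(1) x cl[of "2 * t"]] t rel_interior_subset
        by auto
    qed (use xC in auto)
  qed
qed

text \<open>Along a ray in \<open>C\<close> an affine functional is affine in the parameter. If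
  bounded it is constant there, so it cannot separate \<open>x\<close> from
  \<open>x + v\<close>.\<close>

lemma separated_convex_imp_bounded:
  fixes C :: "'v::euclidean_space set"
  assumes "separated_convex C"
  shows "bounded C"
proof (rule ccontr)
  assume unb: "\<not> bounded C"
  have C: "convex C" "C \<noteq> {}"
    using assms by (auto simp: separated_convex_def)
  then obtain x where x: "x \<in> rel_interior C"
    using rel_interior_eq_empty by blast
  obtain v where v: "v \<noteq> 0" "\<And>t. 0 \<le> t \<Longrightarrow> x + t *\<^sub>R v \<in> C"
    using unbounded_convex_contains_ray[OF C(1) unb x] by metis
  have xC: "x \<in> C" "x + v \<in> C"
    using v(2)[of 0] v(2)[of 1] by auto
  then obtain f :: "'v \<Rightarrow> real" where f: "affine_on C f" "bounded (f ` C)" "f x \<noteq> f (x + v)"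
    using assms v(1) unfolding separated_convex_def by (metis add_cancel_right_right)
  obtain B where B: "\<And>z. z \<in> C \<Longrightarrow> \<bar>f z\<bar> \<le> B"
    using f(2) unfolding bounded_iff by auto
  define c where "c = \<bar>f (x + v) - f x\<bar>"
  have c: "0 < c"
    using f(3) by (simp add: c_def)
  \<comment> \<open>\<open>x + v\<close> divides the segment from \<open>x\<close> to
    \<open>x + T *\<^sub>R v\<close> at ratio \<open>1 / T\<close>, so the change of
    \<open>f\<close> along the ray grows linearly with slope \<open>c\<close>, yet it never exceeds
    \<open>2 * B\<close>.\<close>
  have cB: "c * T \<le> 2 * B" if T: "1 \<le> T" for T
  proof -
    have "f ((1 - 1 / T) *\<^sub>R x + (1 / T) *\<^sub>R (x + T *\<^sub>R v)) = (1 - 1 / T) *\<^sub>R f x + (1 / T) *\<^sub>R f (x + T *\<^sub>R v)"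
      using T xC v(2) by (intro affine_onD[OF f(1)]) auto
    moreover have "(1 - 1 / T) *\<^sub>R x + (1 / T) *\<^sub>R (x + T *\<^sub>R v) = x + v"
      using T by (simp add: algebra_simps)
    ultimately have "(f (x + v) - f x) * T = f (x + T *\<^sub>R v) - f x"
      using T by (simp add: field_simps)
    then have "c * T = \<bar>f (x + T *\<^sub>R v) - f x\<bar>"
      using T by (metis abs_mult abs_of_nonneg c_def order_trans zero_le_one)
    also have "\<dots> \<le> 2 * B"
      using B[OF xC(1)] B[OF v(2)[of T]] T by auto
    finally show ?thesis .
  qed
  have "c * (max 1 ((2 * B + 1) / c)) \<ge> 2 * B + 1"
    using c by (simp add: max_def field_simps)
  then show False
    using cB[of "max 1 ((2 * B + 1) / c)"] by auto
qed

lemma euclidean_realization_bounded_convex: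
  fixes e :: "'a::real_vector \<Rightarrow> 'v::euclidean_space"
  assumes "separated_convex S" "euclidean_realization S e"
  shows "e ` S \<noteq> {}" "convex (e ` S)" "bounded (e ` S)"
  using separated_convex_affine_image[OF assms(1), of e] assms separated_convex_imp_bounded[of "e ` S"]
  by (auto simp: euclidean_realization_def separated_convex_def)

section \<open>Equicontinuity of affine maps and compactness for \<open>d_infty\<close>\<close>

text \<open>A relative ball around some \<open>a\<close> in \<open>X\<close> leaves room to move by
  \<open>r\<close> in any direction \<open>x - y\<close>, and an affine map changes along parallel
  segments in proportion to their lengths. As \<open>r\<close> depends on \<open>X\<close> alone,
  the constant \<open>M / r\<close> serves all affine maps of oscillation at most \<open>M\<close>
  at once.\<close>

lemma affine_on_convex_Lipschitz:
  fixes X :: "'v::euclidean_space set"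
  assumes X: "convex X" "X \<noteq> {}"
  obtains r where "0 < r"
    "\<And>f x y M. \<lbrakk>affine_on X f; \<And>p q. p \<in> X \<Longrightarrow> q \<in> X \<Longrightarrow> norm (f p - f q :: 'w::real_normed_vector) \<le> M; x \<in> X; y \<in> X\<rbrakk>
       \<Longrightarrow> r * norm (f x - f y) \<le> M * norm (x - y)"
proof -
  obtain a where "a \<in> rel_interior X"
    using X rel_interior_eq_empty by blast
  then obtain r where a: "a \<in> X" and r: "0 < r" "cball a r \<inter> affine hull X \<subseteq> X"
    by (auto simp: mem_rel_interior_cball)
  show ?thesis
  proof (rule that[OF r(1)])
    fix f :: "'v \<Rightarrow> 'w" and x y M
    assume f: "affine_on X f" "\<And>p q. p \<in> X \<Longrightarrow> q \<in> X \<Longrightarrow> norm (f p - f q) \<le> M"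
      and xy: "x \<in> X" "y \<in> X"
    show "r * norm (f x - f y) \<le> M * norm (x - y)"
    proof (cases "x = y")
      case False
      define N where "N = norm (x - y)"
      \<comment> \<open>\<open>z\<close> is \<open>a\<close> shifted by length \<open>r\<close> in
        the direction from \<open>y\<close> to \<open>x\<close>, hence still in the relative ball.
        The ratio \<open>t\<close> is the solution of \<open>N * (1 - t) = t * r\<close>.\<close>
      define z where "z = a + (r / N) *\<^sub>R (x - y)"
      define t where "t = N / (N + r)"
      have N: "0 < N"
        using False by (simp add: N_def)
      have "z \<in> affine hull X"
        unfolding z_def using a xy
        by (intro mem_affine_3_minus affine_affine_hull hull_inc)
      moreover have "z \<in> cball a r"
        using N r(1) by (simp add: z_def dist_norm N_def)
      ultimately have zX: "z \<in> X"
        using r(2) by blast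
      have t: "0 \<le> t" "t \<le> 1" "N * (1 - t) = t * r" "0 < 1 - t" "t * (N + r) = N"
        using N r(1) by (auto simp: t_def field_simps)
      \<comment> \<open>The segments from \<open>y\<close> to \<open>z\<close> and from \<open>x\<close> to \<open>a\<close> cross at the same ratio.\<close>
      have *: "(1 - t) *\<^sub>R y + t *\<^sub>R z = (1 - t) *\<^sub>R x + t *\<^sub>R a"
      proof -
        have "t * (r / N) = 1 - t"
          using t(3) N by (simp add: field_simps)
        then have "t *\<^sub>R z = t *\<^sub>R a + (1 - t) *\<^sub>R (x - y)"
          by (simp add: z_def scaleR_add_right)
        then show ?thesis
          by (simp add: scaleR_diff_right)
      qed
      then have "(1 - t) *\<^sub>R f y + t *\<^sub>R f z = (1 - t) *\<^sub>R f x + t *\<^sub>R f a"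
        using affine_onD[OF f(1) xy(2) zX t(1,2)] affine_onD[OF f(1) xy(1) a t(1,2)] by simp
      then have "(1 - t) *\<^sub>R (f x - f y) = t *\<^sub>R (f z - f a)"
        by (simp add: algebra_simps)
      then have "norm ((1 - t) *\<^sub>R (f x - f y)) = norm (t *\<^sub>R (f z - f a))"
        by simp
      then have "(1 - t) * norm (f x - f y) = t * norm (f z - f a)"
        using t by simp
      also have "\<dots> \<le> t * M"
        using f(2)[OF zX a] t(1) by (rule mult_left_mono)
      finally have "r * ((1 - t) * norm (f x - f y)) \<le> r * (t * M)"
        using r(1) by (intro mult_left_mono) auto
      also have "\<dots> = (1 - t) * (M * N)"
        using t(3) by (simp add: mult_ac)
      finally have "(1 - t) * (r * norm (f x - f y)) \<le> (1 - t) * (M * N)"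
        by (simp add: mult_ac)
      then show ?thesis
        using t(4) by (simp add: N_def)
    qed simp
  qed
qed

lemma affine_cmaps_subset: "affine_cmaps S1 S2 \<subseteq> cmaps S1 S2"
  by (auto simp: affine_cmaps_def)

lemma cmaps_in_closure: "f \<in> cmaps S1 S2 \<Longrightarrow> s \<in> closure S1 \<Longrightarrow> f s \<in> closure S2"
  by (auto simp: cmaps_def)

lemma Metric_space_affine_cmaps:
  assumes "S1 \<noteq> {}" "bounded S2"
  shows "Metric_space (affine_cmaps S1 S2) (d_infty S1 S2)"
  using Metric_space.subspace[OF Metric_space_d_infty[OF assms] affine_cmaps_subset] .

text \<open>All distances are at most the diameter of \<open>closure S2\<close>, so the supremum is
  a genuine upper bound.\<close>

lemma dist_le_d_infty:
  assumes "bounded S2" "f \<in> cmaps S1 S2" "g \<in> cmaps S1 S2" "s \<in> closure S1"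
  shows "dist (f s) (g s) \<le> d_infty S1 S2 f g"
proof -
  have "bdd_above ((\<lambda>s. dist (f s) (g s)) ` closure S1)"
    using assms cmaps_in_closure[of _ S1 S2] diameter_bounded_bound[OF bounded_closure[OF assms(1)]]
    by (intro bdd_aboveI2[where M = "diameter (closure S2)"]) auto
  then show ?thesis
    using assms by (auto simp: d_infty_def intro: cSUP_upper)
qed

lemma d_infty_le:
  assumes "S1 \<noteq> {}" "f \<in> cmaps S1 S2" "g \<in> cmaps S1 S2"
    and "\<And>s. s \<in> closure S1 \<Longrightarrow> dist (f s) (g s) \<le> c"
  shows "d_infty S1 S2 f g \<le> c"
  using assms by (auto simp: d_infty_def intro!: cSUP_least)

text \<open>The common Lipschitz constant gives a uniformly convergent subsequence. Affinity and
  values in the closed set \<open>closure S2\<close> survive pointwise limits, so the limit is again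
  in the space.\<close>

lemma compact_space_affine_cmaps:
  assumes S1: "S1 \<noteq> {}" "convex S1" "bounded S1" and S2: "bounded S2"
  shows "compact_space (Metric_space.mtopology (affine_cmaps S1 S2) (d_infty S1 S2))"
proof -
  interpret Metric_space "affine_cmaps S1 S2" "d_infty S1 S2"
    using S1(1) S2 by (rule Metric_space_affine_cmaps)
  show ?thesis
    unfolding compact_space_sequentially
  proof (intro allI impI)
    fix \<sigma> :: "nat \<Rightarrow> 'a \<Rightarrow> 'b"
    assume "range \<sigma> \<subseteq> affine_cmaps S1 S2"
    then have \<sigma>: "\<sigma> n \<in> cmaps S1 S2" "affine_on (closure S1) (\<sigma> n)" "\<sigma> n \<in> affine_cmaps S1 S2" for n
      by (auto simp: affine_cmaps_def)
    obtain B where B: "\<And>y. y \<in> closure S2 \<Longrightarrow> norm y \<le> B"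
      using bounded_closure[OF S2] unfolding bounded_iff by metis
    define D where "D = 2 * \<bar>B\<bar> + 1"
    have D: "norm (\<sigma> n p - \<sigma> n q) \<le> D" if "p \<in> closure S1" "q \<in> closure S1" for n p q
    proof -
      have "norm (\<sigma> n p) \<le> B" "norm (\<sigma> n q) \<le> B"
        using B cmaps_in_closure[OF \<sigma>(1)] that by blast+
      then show ?thesis
        using norm_triangle_ineq4[of "\<sigma> n p" "\<sigma> n q"] by (simp add: D_def)
    qed
    obtain r where r: "0 < r" and
      lip: "\<And>n x y. x \<in> closure S1 \<Longrightarrow> y \<in> closure S1 \<Longrightarrow> r * norm (\<sigma> n x - \<sigma> n y) \<le> D * norm (x - y)"
      using affine_on_convex_Lipschitz[of "closure S1", where 'w = 'b] S1 \<sigma>(2) D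
      by (smt (verit) closure_eq_empty convex_closure)
    obtain g k where g: "continuous_on (closure S1) g" "strict_mono (k :: nat \<Rightarrow> nat)" and
      conv: "\<And>e. 0 < e \<Longrightarrow> \<exists>N. \<forall>n x. n \<ge> N \<and> x \<in> closure S1 \<longrightarrow> norm (\<sigma> (k n) x - g x) < e"
    proof (rule Arzela_Ascoli[of "closure S1" \<sigma> B])
      show "compact (closure S1)"
        using S1(3) by simp
      show "norm (\<sigma> n x) \<le> B" if "x \<in> closure S1" for n x
        using that \<sigma>(1) B cmaps_in_closure by blast
      show "\<exists>d. 0 < d \<and> (\<forall>n y. y \<in> closure S1 \<and> norm (x - y) < d \<longrightarrow> norm (\<sigma> n x - \<sigma> n y) < e)"
        if "x \<in> closure S1" "0 < e" for x e
      proof (intro exI[of _ "r * e / D"] conjI allI impI)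
        show "0 < r * e / D"
          using r that by (simp add: D_def)
        fix n y
        assume y: "y \<in> closure S1 \<and> norm (x - y) < r * e / D"
        then have "D * norm (x - y) < r * e"
          by (simp add: D_def field_simps)
        then have "r * norm (\<sigma> n x - \<sigma> n y) < r * e"
          using lip[of x y n] that y by linarith
        then show "norm (\<sigma> n x - \<sigma> n y) < e"
          using r by simp
      qed
    qed metis
    have lim: "(\<lambda>n. \<sigma> (k n) x) \<longlonglongrightarrow> g x" if "x \<in> closure S1" for x
      using conv that unfolding lim_sequentially dist_norm by meson
    \<comment> \<open>Off \<open>closure S1\<close> the limit \<open>g\<close> is arbitrary, whereas
      members of \<open>cmaps\<close> have to be \<open>undefined\<close> there.\<close>
    define l where "l = restrict g (closure S1)"
    have lim_l: "(\<lambda>n. \<sigma> (k n) x) \<longlonglongrightarrow> l x" if "x \<in> closure S1" for x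
      using lim[OF that] that by (simp add: l_def)
    have "l x \<in> closure S2" if "x \<in> closure S1" for x
      using closed_sequentially[OF closed_closure _ lim_l[OF that]] cmaps_in_closure[OF \<sigma>(1) that]
      by blast
    moreover have "continuous_on (closure S1) l"
      using g(1) by (simp add: l_def)
    ultimately have l_cmaps: "l \<in> cmaps S1 S2"
      by (auto simp: cmaps_def l_def)
    have "affine_on (closure S1) l"
      unfolding affine_on_def
    proof (intro ballI)
      fix x y and t :: real
      assume xy: "x \<in> closure S1" "y \<in> closure S1" and t: "t \<in> {0..1}"
      let ?z = "(1 - t) *\<^sub>R x + t *\<^sub>R y"
      have z: "?z \<in> closure S1"
        using convex_closure[OF S1(2)] xy t by (auto simp: convex_alt)
      have "(\<lambda>n. \<sigma> (k n) ?z) = (\<lambda>n. (1 - t) *\<^sub>R \<sigma> (k n) x + t *\<^sub>R \<sigma> (k n) y)"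
        using xy t by (auto intro: affine_onD[OF \<sigma>(2)])
      also have "\<dots> \<longlonglongrightarrow> (1 - t) *\<^sub>R l x + t *\<^sub>R l y"
        using lim_l xy by (intro tendsto_intros)
      finally show "l ?z = (1 - t) *\<^sub>R l x + t *\<^sub>R l y"
        using lim_l[OF z] LIMSEQ_unique by blast
    qed
    with l_cmaps have l: "l \<in> affine_cmaps S1 S2"
      by (simp add: affine_cmaps_def)
    have "limitin mtopology (\<sigma> \<circ> k) l sequentially"
      unfolding limitin_metric
    proof (intro conjI allI impI l)
      fix e :: real
      assume e: "0 < e"
      \<comment> \<open>The strict pointwise bound becomes a weak one for the supremum;
        \<open>e / 2\<close> keeps the result strictly below \<open>e\<close>.\<close>
      obtain N where N: "\<And>n x. n \<ge> N \<Longrightarrow> x \<in> closure S1 \<Longrightarrow> norm (\<sigma> (k n) x - g x) < e / 2"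
        using conv[of "e / 2"] e by auto
      have "d_infty S1 S2 (\<sigma> (k n)) l \<le> e / 2" if "n \<ge> N" for n
        using N[OF that] S1(1) \<sigma>(1) l_cmaps by (intro d_infty_le) (auto simp: l_def dist_norm less_imp_le)
      then show "eventually (\<lambda>n. (\<sigma> \<circ> k) n \<in> affine_cmaps S1 S2 \<and> d_infty S1 S2 ((\<sigma> \<circ> k) n) l < e) sequentially"
        using e \<sigma>(3) by (fastforce simp: eventually_sequentially intro: exI[of _ N])
    qed
    then show "\<exists>l k. l \<in> affine_cmaps S1 S2 \<and> strict_mono k \<and> limitin mtopology (\<sigma> \<circ> k) l sequentially"
      using l g(2) by blast
  qed
qed

section \<open>Essential sets and the Hausdorff property\<close>

text \<open>This lets the essential subbase test the value of a map at a point of \<open>S\<close>.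
  It fails at points of \<open>closure S - S\<close>, where \<open>{s} \<inter> S\<close> is
  empty.\<close>

lemma essential_closed_singleton:
  assumes "s \<in> S"
  shows "essential_closed S {s}"
proof -
  have "s \<in> closure S"
    using assms closure_subset by blast
  then have "closedin (top_of_set (closure S)) {s}"
    by (simp add: closed_subset)
  then show ?thesis
    using assms by (simp add: essential_closed_def closure_of_closedin)
qed

text \<open>The operation of adding \<open>closure S - S\<close> and taking the interior is
  idempotent, so it produces an essential open set from any \<open>U\<close>.\<close>

lemma essential_open_interior_of:
  "essential_open S ((top_of_set (closure S)) interior_of (U \<union> (closure S - S)))"
  unfolding essential_open_def
proof (intro conjI openin_interior_of subset_antisym)
  let ?U = "(top_of_set (closure S)) interior_of (U \<union> (closure S - S))"
  show "(top_of_set (closure S)) interior_of (?U \<union> (closure S - S)) \<subseteq> ?U"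
    using interior_of_subset[of "top_of_set (closure S)"] by (intro interior_of_mono) fast
  show "?U \<subseteq> (top_of_set (closure S)) interior_of (?U \<union> (closure S - S))"
    by (intro interior_of_maximal openin_interior_of Un_upper1)
qed

text \<open>Making disjoint open sets essential adds only points outside of \<open>S\<close>. The
  enlarged sets therefore meet in an open set that misses \<open>S\<close>, and this is empty
  because \<open>S\<close> is dense in \<open>closure S\<close>.\<close>

lemma essential_open_separation:
  assumes "p \<in> closure S" "q \<in> closure S" "p \<noteq> q"
  obtains U V where "essential_open S U" "essential_open S V" "p \<in> U" "q \<in> V" "disjnt U V"
proof -
  obtain U0 V0 where UV: "open U0" "open V0" "p \<in> U0" "q \<in> V0" "U0 \<inter> V0 = {}"
    using hausdorff[OF assms(3)] by metis
  let ?X = "top_of_set (closure S)"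
  let ?E = "\<lambda>W. ?X interior_of ((closure S \<inter> W) \<union> (closure S - S))"
  have sub: "closure S \<inter> W \<subseteq> ?E W" if "open W" for W
    using that by (intro interior_of_maximal openin_open_Int) auto
  have opn: "openin ?X (?E U0 \<inter> ?E V0)"
    by (intro openin_Int openin_interior_of)
  have dj: "(?E U0 \<inter> ?E V0) \<inter> S = {}"
    using interior_of_subset[of ?X "(closure S \<inter> U0) \<union> (closure S - S)"]
      interior_of_subset[of ?X "(closure S \<inter> V0) \<union> (closure S - S)"] UV(5) by blast
  obtain W where W: "open W" "?E U0 \<inter> ?E V0 = closure S \<inter> W"
    using opn by (auto simp: openin_open)
  have "W \<inter> S = {}"
    using dj W(2) closure_subset[of S] by blast
  then have "W \<inter> closure S = {}"
    using W(1) by (simp add: open_Int_closure_eq_empty)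
  then have "disjnt (?E U0) (?E V0)"
    using W(2) by (auto simp: disjnt_def)
  then show ?thesis
    using that[OF essential_open_interior_of essential_open_interior_of] sub[OF UV(1)] sub[OF UV(2)]
      UV(3,4) assms(1,2) by blast
qed

lemma essential_open_closure: "essential_open S (closure S)"
  by (simp add: essential_open_def interior_of_openin sup_absorb1)

lemma essential_closed_empty: "essential_closed S {}"
  by (simp add: essential_closed_def)

lemma topspace_essential_compact_open_topology:
  "topspace (essential_compact_open_topology S1 S2) = cmaps S1 S2"
proof -
  have "cmaps S1 S2 \<in> {{f \<in> cmaps S1 S2. f ` K \<subseteq> U} | K U. essential_closed S1 K \<and> essential_open S2 U}"
    using essential_closed_empty[of S1] essential_open_closure[of S2] by fastforce
  then show ?thesis
    unfolding essential_compact_open_topology_def topology_generated_by_topspace by blast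
qed

lemma topspace_compact_open_topology:
  "topspace (compact_open_topology S1 S2) = cmaps S1 S2"
proof -
  have "cmaps S1 S2 \<in> {{f \<in> cmaps S1 S2. f ` K \<subseteq> U} | K U.
      compactin (top_of_set (closure S1)) K \<and> openin (top_of_set (closure S2)) U}"
    by (auto intro!: exI[of _ "{}"])
  then show ?thesis
    unfolding compact_open_topology_def topology_generated_by_topspace by blast
qed

lemma Hausdorff_essential_compact_open_topology:
  "Hausdorff_space (essential_compact_open_topology S1 S2)"
  unfolding Hausdorff_space_def topspace_essential_compact_open_topology
proof (intro allI impI)
  fix f g
  assume fg: "f \<in> cmaps S1 S2 \<and> g \<in> cmaps S1 S2 \<and> f \<noteq> g"
  \<comment> \<open>The maps must be told apart in \<open>S1\<close>, where singletons are
    essential. Continuous maps that agree on \<open>S1\<close> agree on its closure, and both are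
    \<open>undefined\<close> elsewhere.\<close>
  have "\<exists>s\<in>S1. f s \<noteq> g s"
  proof (rule ccontr)
    assume "\<not> (\<exists>s\<in>S1. f s \<noteq> g s)"
    then have "f s = g s" if "s \<in> closure S1" for s
      using fg that continuous_constant_on_closure[of S1 "\<lambda>x. f x - g x" 0 s]
      by (auto simp: cmaps_def continuous_on_diff)
    then show False
      using fg PiE_ext[of f "closure S1" _ g] by (auto simp: cmaps_def)
  qed
  then obtain s where s: "s \<in> S1" "f s \<noteq> g s" ..
  have "f s \<in> closure S2" "g s \<in> closure S2"
    using fg s closure_subset[of S1] cmaps_in_closure by blast+
  then obtain U V where UV: "essential_open S2 U" "essential_open S2 V" "f s \<in> U" "g s \<in> V" "disjnt U V"
    using essential_open_separation s(2) by metis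
  have opn: "openin (essential_compact_open_topology S1 S2) {h \<in> cmaps S1 S2. h ` {s} \<subseteq> W}"
    if "essential_open S2 W" for W
    unfolding essential_compact_open_topology_def
    using that essential_closed_singleton[OF s(1)] by (intro topology_generated_by_Basis) blast
  show "\<exists>U V. openin (essential_compact_open_topology S1 S2) U \<and>
      openin (essential_compact_open_topology S1 S2) V \<and> f \<in> U \<and> g \<in> V \<and> disjnt U V"
    using opn[OF UV(1)] opn[OF UV(2)] UV(3-5) fg
    by (intro exI[of _ "{h \<in> cmaps S1 S2. h ` {s} \<subseteq> U}"] exI[of _ "{h \<in> cmaps S1 S2. h ` {s} \<subseteq> V}"])
       (auto simp: disjnt_iff)
qed

section \<open>Comparison of the three topologies\<close>

text \<open>Closed subsets of the compact set \<open>closure S1\<close> are compact, so each set of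
  the essential subbase belongs to the compact-open subbase.\<close>

lemma openin_essential_imp_compact_open:
  assumes "bounded S1" and "openin (essential_compact_open_topology S1 S2) W"
  shows "openin (compact_open_topology S1 S2) W"
proof -
  have "openin (compact_open_topology S1 S2) {f \<in> cmaps S1 S2. f ` K \<subseteq> U}"
    if "essential_closed S1 K" "essential_open S2 U" for K U
  proof -
    have "compact_space (top_of_set (closure S1))"
      using assms(1) by (simp add: compact_space_subtopology)
    then have "compactin (top_of_set (closure S1)) K"
      using that(1) closedin_compact_space by (auto simp: essential_closed_def)
    then show ?thesis
      unfolding compact_open_topology_def
      using that(2) by (intro topology_generated_by_Basis) (auto simp: essential_open_def)
  qed
  \<comment> \<open>Inclusion of topologies is phrased as continuity of \<open>id\<close>, which
    reduces it to subbasic sets.\<close>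
  then have "continuous_map (compact_open_topology S1 S2) (essential_compact_open_topology S1 S2) id"
    using topspace_essential_compact_open_topology[of S1 S2]
    unfolding essential_compact_open_topology_def continuous_on_generated_topo_iff topology_generated_by_topspace
    by (auto simp: topspace_compact_open_topology Int_absorb2 Int_def conj_ac cong: conj_cong)
  then show ?thesis
    using assms(2) openin_subset[OF assms(2)]
    by (auto simp: continuous_map_alt topspace_compact_open_topology
        topspace_essential_compact_open_topology Int_absorb2)
qed

lemma openin_mtopology_compact_open:
  assumes S1: "S1 \<noteq> {}" and S2: "bounded S2"
    and K: "compactin (top_of_set (closure S1)) K" and U: "openin (top_of_set (closure S2)) U"
  shows "openin (Metric_space.mtopology (affine_cmaps S1 S2) (d_infty S1 S2))
    {f \<in> affine_cmaps S1 S2. f ` K \<subseteq> U}"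
proof -
  interpret Metric_space "affine_cmaps S1 S2" "d_infty S1 S2"
    using S1 S2 by (rule Metric_space_affine_cmaps)
  have K: "compact K" "K \<subseteq> closure S1"
    using K by (auto simp: compactin_subtopology)
  obtain W where W: "open W" "U = closure S2 \<inter> W"
    using U by (auto simp: openin_open)
  show ?thesis
    unfolding openin_mtopology
  proof (intro conjI allI impI)
    fix f
    assume "f \<in> {f \<in> affine_cmaps S1 S2. f ` K \<subseteq> U}"
    then have f: "f \<in> affine_cmaps S1 S2" "f \<in> cmaps S1 S2" "f ` K \<subseteq> W"
      using W(2) by (auto simp: affine_cmaps_def)
    have "compact (f ` K)"
      using f(2) K by (auto simp: cmaps_def intro: compact_continuous_image continuous_on_subset)
    moreover have "closed (- W)" "f ` K \<inter> - W = {}"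
      using W(1) f(3) by auto
    ultimately obtain r where r: "0 < r" "\<And>x y. x \<in> f ` K \<Longrightarrow> y \<in> - W \<Longrightarrow> r \<le> dist x y"
      using separate_compact_closed by metis
    have "g ` K \<subseteq> U" if g: "g \<in> affine_cmaps S1 S2" "d_infty S1 S2 f g < r" for g
    proof
      fix y
      assume "y \<in> g ` K"
      then obtain s where s: "s \<in> K" "y = g s" by auto
      have g': "g \<in> cmaps S1 S2"
        using g(1) affine_cmaps_subset by blast
      have "dist (f s) (g s) < r"
        using dist_le_d_infty[OF S2 f(2) g', of s] g(2) s(1) K(2) by auto
      then have "g s \<in> W"
        using r(2)[of "f s" "g s"] s(1) by force
      then show "y \<in> U"
        using cmaps_in_closure[OF g', of s] s K(2) W(2) by auto
    qed
    then have "mball f r \<subseteq> {f \<in> affine_cmaps S1 S2. f ` K \<subseteq> U}"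
      unfolding mball_def by blast
    then show "\<exists>r>0. mball f r \<subseteq> {f \<in> affine_cmaps S1 S2. f ` K \<subseteq> U}"
      using r(1) by blast
  qed auto
qed

lemma openin_compact_open_imp_mtopology:
  assumes "S1 \<noteq> {}" "bounded S2"
    and "openin (subtopology (compact_open_topology S1 S2) (affine_cmaps S1 S2)) W"
  shows "openin (Metric_space.mtopology (affine_cmaps S1 S2) (d_infty S1 S2)) W"
proof -
  interpret Metric_space "affine_cmaps S1 S2" "d_infty S1 S2"
    using assms(1,2) by (rule Metric_space_affine_cmaps)
  have preimage: "id -` {f \<in> cmaps S1 S2. f ` K \<subseteq> U} \<inter> topspace mtopology
      = {f \<in> affine_cmaps S1 S2. f ` K \<subseteq> U}" for K U
    using affine_cmaps_subset[of S1 S2] by auto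
  have "continuous_map mtopology (compact_open_topology S1 S2) id"
    unfolding compact_open_topology_def
  proof (rule continuous_on_generated_topo)
    show "id ` topspace mtopology \<subseteq> \<Union> {{f \<in> cmaps S1 S2. f ` K \<subseteq> U} | K U.
        compactin (top_of_set (closure S1)) K \<and> openin (top_of_set (closure S2)) U}"
      using topspace_compact_open_topology[of S1 S2] affine_cmaps_subset[of S1 S2]
      unfolding compact_open_topology_def topology_generated_by_topspace by auto
  qed (use preimage openin_mtopology_compact_open[OF assms(1,2)] in auto)
  then have "continuous_map mtopology (subtopology (compact_open_topology S1 S2) (affine_cmaps S1 S2)) id"
    by (auto simp: continuous_map_in_subtopology)
  then show ?thesis
    using assms(3) openin_subset[OF assms(3)]
    by (auto simp: continuous_map_alt Int_absorb2)
qed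

theorem proposition8:
  fixes S1 :: "'a::real_vector set" and S2 :: "'b::real_vector set"
    and e1 :: "'a \<Rightarrow> 'v::euclidean_space" and e2 :: "'b \<Rightarrow> 'w::euclidean_space"
  assumes "separated_convex S1" and "separated_convex S2"
    and "finite_dimensional S1" and "finite_dimensional S2"
    and "euclidean_realization S1 e1" and "euclidean_realization S2 e2"
  shows "subtopology (essential_compact_open_topology (e1 ` S1) (e2 ` S2)) (affine_cmaps (e1 ` S1) (e2 ` S2))
           = Metric_space.mtopology (affine_cmaps (e1 ` S1) (e2 ` S2)) (d_infty (e1 ` S1) (e2 ` S2))
       \<and> subtopology (essential_compact_open_topology (e1 ` S1) (e2 ` S2)) (affine_cmaps (e1 ` S1) (e2 ` S2))
           = subtopology (compact_open_topology (e1 ` S1) (e2 ` S2)) (affine_cmaps (e1 ` S1) (e2 ` S2))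
       \<and> compact_space
           (subtopology (essential_compact_open_topology (e1 ` S1) (e2 ` S2)) (affine_cmaps (e1 ` S1) (e2 ` S2)))"
proof -
  note C1 = euclidean_realization_bounded_convex[OF assms(1,5)]
    and C2 = euclidean_realization_bounded_convex[OF assms(2,6)]
  let ?A = "affine_cmaps (e1 ` S1) (e2 ` S2)"
  let ?E = "subtopology (essential_compact_open_topology (e1 ` S1) (e2 ` S2)) ?A"
  let ?K = "subtopology (compact_open_topology (e1 ` S1) (e2 ` S2)) ?A"
  interpret Metric_space ?A "d_infty (e1 ` S1) (e2 ` S2)"
    using C1(1) C2(3) by (rule Metric_space_affine_cmaps)
  have cpt: "compact_space mtopology"
    using C1 C2(3) by (rule compact_space_affine_cmaps)
  have EK: "openin ?K W" if "openin ?E W" for W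
    using that openin_essential_imp_compact_open[OF C1(3)] by (auto simp: openin_subtopology)
  have KM: "openin mtopology W" if "openin ?K W" for W
    using C1(1) C2(3) that by (rule openin_compact_open_imp_mtopology)
  \<comment> \<open>Equal carriers are required for the principle that a compact topology finer than
    a Hausdorff one coincides with it.\<close>
  have "topspace ?E = ?A"
    using affine_cmaps_subset by (auto simp: topspace_essential_compact_open_topology)
  then have EM: "?E = mtopology"
    using cpt EK KM
    by (intro compact_Hausdorff_space_optimal[symmetric])
       (auto intro: Hausdorff_space_subtopology Hausdorff_essential_compact_open_topology)
  \<comment> \<open>\<open>?K\<close> lies between \<open>?E\<close> and the metric topology, which
    are already equal.\<close>
  moreover have "?E = ?K"
    unfolding topology_eq using EK KM EM by metis
  ultimately show ?thesis
    using cpt by simp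
qed

end
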